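(* Let $R$ be a counterexample ring. Then $\mathcal{N}(R)$ is not a two-sided ideal of $R[x]$.
   Context: Rings are associative with unity. For a finite ring $R$, $R[x]$ is the ring of polynomials over $R$ in a central indeterminate $x$. Polynomials satisfy right evaluation: for $f(x)=\sum_i c_i x^i$ (coefficients on the left) and $a\in R$, $f(a)=\sum_i c_i a^i$. The null ideal is $\mathcal{N}(R)=\{f\in R[x] \mid f(a)=0 \text{ for all } a\in R\}$. Let $J$ be the Jacobson radical of the finite ring $R$. Its nilpotency is the smallest positive integer $n$ with $J^n=\{0\}$. Write $R/J\cong\bigoplus_{i=1}^t M_{n_i}(F_i)$ with each $F_i$ a finite field. Fix idempotents $\mathfrak{e}_1,\dots,\mathfrak{e}_t\in R$ such that $1=\mathfrak{e}_1+\cdots+\mathfrak{e}_t$, $\mathfrak{e}_i\mathfrak{e}_j=0$ if and only if $i\neq j$, and $\mathfrak{e}_i \bmod J$ is the multiplicative identity of $M_{n_i}(F_i)$; set $E(R)=\{\mathfrak{e}_1,\dots,\mathfrak{e}_t\}$. $R$ is called a counterexample ring if all of the following hold: (1) $R/J\cong\mathbb{F}_2\oplus\mathbb{F}_2$; (2) $J$ has nilpotency $n\geq 4$; (3) there exists $r\in R$ such that $(r^2+r)^{n-1}\neq 0$; (4) there exists $\mathfrak{e}\in E(R)$ such that, with $\mathfrak{f}=1-\mathfrak{e}$: (4a) $J^{n-1}=\mathfrak{e}J^{n-1}\mathfrak{f}$; (4b) $\mathfrak{e}J^{n-2}\mathfrak{f}=\mathfrak{e}J^{n-1}\mathfrak{f}$;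 (4c) as additive groups, $\mathfrak{e}J^2\mathfrak{f}$ is an index $2$ subgroup of $\mathfrak{e}J\mathfrak{f}$. *)

theory Defs
  imports
    "HOL-Algebra.UnivPoly"
    "HOL-Algebra.Chinese_Remainder"
    "HOL-Algebra.Ideal_Product"
    "HOL-Number_Theory.Residues"
begin

definition left_ideal :: "'a set \<Rightarrow> ('a, 'm) ring_scheme \<Rightarrow> bool"
  where "left_ideal I R \<longleftrightarrow>
    additive_subgroup I R \<and> (\<forall>a\<in>I. \<forall>x\<in>carrier R. x \<otimes>\<^bsub>R\<^esub> a \<in> I)"

definition maximal_left_ideal :: "'a set \<Rightarrow> ('a, 'm) ring_scheme \<Rightarrow> bool"
  where "maximal_left_ideal I R \<longleftrightarrow>
    left_ideal I R \<and> I \<noteq> carrier R \<and>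
    (\<forall>K. left_ideal K R \<and> I \<subseteq> K \<and> K \<noteq> carrier R \<longrightarrow> K = I)"

definition jacobson_radical :: "('a, 'm) ring_scheme \<Rightarrow> 'a set"
  where "jacobson_radical R = carrier R \<inter> \<Inter>{I. maximal_left_ideal I R}"

text \<open>Powers of a two-sided ideal. The product of \<^const>\<open>ideals_set\<close> is the additive span of
  the pairwise products, also for noncommutative rings; the zeroth power is the whole ring.\<close>

abbreviation ideal_pow :: "('a, 'm) ring_scheme \<Rightarrow> 'a set \<Rightarrow> nat \<Rightarrow> 'a set"
  where "ideal_pow R I n \<equiv> I [^]\<^bsub>ideals_set R\<^esub> n"

text \<open>Only meaningful when some power of the ideal vanishes, as is the case for the Jacobson
  radical of a finite ring.\<close>

definition nilpotency :: "('a, 'm) ring_scheme \<Rightarrow> 'a set \<Rightarrow> nat"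
  where "nilpotency R I = (LEAST n. 0 < n \<and> ideal_pow R I n = {\<zero>\<^bsub>R\<^esub>})"

text \<open>Square matrices of size \<open>n\<close>, with rows and columns indexed by \<open>{..<n}\<close>; matrices are
  extensional functions, so that equality in the carrier is equality of entries.\<close>

definition matrix_ring :: "('a, 'm) ring_scheme \<Rightarrow> nat \<Rightarrow> (nat \<times> nat \<Rightarrow> 'a) ring"
  where "matrix_ring F n =
    \<lparr>carrier = ({..<n} \<times> {..<n}) \<rightarrow>\<^sub>E carrier F,
     monoid.mult = (\<lambda>A B. \<lambda>(i, j)\<in>{..<n} \<times> {..<n}. \<Oplus>\<^bsub>F\<^esub>k\<in>{..<n}. A (i, k) \<otimes>\<^bsub>F\<^esub> B (k, j)),
     one = (\<lambda>(i, j)\<in>{..<n} \<times> {..<n}. if i = j then \<one>\<^bsub>F\<^esub> else \<zero>\<^bsub>F\<^esub>),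
     zero = (\<lambda>(i, j)\<in>{..<n} \<times> {..<n}. \<zero>\<^bsub>F\<^esub>),
     add = (\<lambda>A B. \<lambda>(i, j)\<in>{..<n} \<times> {..<n}. A (i, j) \<oplus>\<^bsub>F\<^esub> B (i, j))\<rparr>"

text \<open>A list \<open>[(n\<^sub>1, F\<^sub>1), \<dots>, (n\<^sub>t, F\<^sub>t)]\<close> stands for the direct sum of the matrix rings of size
  \<open>n\<^sub>i\<close> over \<open>F\<^sub>i\<close>.\<close>

abbreviation matrix_rings :: "(nat \<times> 'f ring) list \<Rightarrow> (nat \<times> nat \<Rightarrow> 'f) ring list"
  where "matrix_rings cs \<equiv> map (\<lambda>(n, F). matrix_ring F n) cs"

text \<open>The isomorphism \<open>\<phi>\<close> is recorded because the idempotents below are chosen relative to it.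
  Since finite fields are countable, using one type for the elements of all the fields is no
  restriction.\<close>

definition wedderburn_decomposition ::
    "('a, 'm) ring_scheme \<Rightarrow> (nat \<times> 'f ring) list \<Rightarrow>
      ('a set \<Rightarrow> (nat \<times> nat \<Rightarrow> 'f) list) \<Rightarrow> bool"
  where "wedderburn_decomposition R cs \<phi> \<longleftrightarrow>
    (\<forall>(n, F)\<in>set cs. 0 < n \<and> field F \<and> finite (carrier F)) \<and>
    \<phi> \<in> ring_iso (R Quot jacobson_radical R) (RDirProd_list (matrix_rings cs))"

text \<open>The identity of the \<open>i\<close>-th summand, as an element of the direct sum.\<close>

definition summand_one :: "('a, 'm) ring_scheme list \<Rightarrow> nat \<Rightarrow> 'a list"
  where "summand_one Rs i =
    map (\<lambda>j. if j = i then \<one>\<^bsub>Rs ! j\<^esub> else \<zero>\<^bsub>Rs ! j\<^esub>) [0..<length Rs]"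

text \<open>The set \<open>E(R)\<close> is \<open>set es\<close> for a list \<open>es\<close> with the following property.\<close>

definition wedderburn_idempotents ::
    "('a, 'm) ring_scheme \<Rightarrow> (nat \<times> 'f ring) list \<Rightarrow>
      ('a set \<Rightarrow> (nat \<times> nat \<Rightarrow> 'f) list) \<Rightarrow> 'a list \<Rightarrow> bool"
  where "wedderburn_idempotents R cs \<phi> es \<longleftrightarrow>
    length es = length cs \<and>
    set es \<subseteq> carrier R \<and>
    (\<forall>e\<in>set es. e \<otimes>\<^bsub>R\<^esub> e = e) \<and>
    \<one>\<^bsub>R\<^esub> = (\<Oplus>\<^bsub>R\<^esub>i\<in>{..<length es}. es ! i) \<and>
    (\<forall>i<length es. \<forall>j<length es. es ! i \<otimes>\<^bsub>R\<^esub> es ! j = \<zero>\<^bsub>R\<^esub> \<longleftrightarrow> i \<noteq> j) \<and>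
    (\<forall>i<length es.
      \<phi> (jacobson_radical R +>\<^bsub>R\<^esub> (es ! i)) = summand_one (matrix_rings cs) i)"

text \<open>The set \<open>e A f\<close>.\<close>

definition sandwich :: "('a, 'm) ring_scheme \<Rightarrow> 'a \<Rightarrow> 'a set \<Rightarrow> 'a \<Rightarrow> 'a set"
  where "sandwich R e A f = (\<lambda>x. e \<otimes>\<^bsub>R\<^esub> x \<otimes>\<^bsub>R\<^esub> f) ` A"

definition index2_add_subgroup :: "('a, 'm) ring_scheme \<Rightarrow> 'a set \<Rightarrow> 'a set \<Rightarrow> bool"
  where "index2_add_subgroup R H K \<longleftrightarrow>
    subgroup H ((add_monoid R)\<lparr>carrier := K\<rparr>) \<and>
    card (rcosets\<^bsub>(add_monoid R)\<lparr>carrier := K\<rparr>\<^esub> H) = 2"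

definition counterexample_ring :: "('a, 'm) ring_scheme \<Rightarrow> 'a set \<Rightarrow> bool"
  where "counterexample_ring R E \<longleftrightarrow>
    (let J = jacobson_radical R; n = nilpotency R J in
      R Quot J \<simeq> RDirProd (residue_ring 2) (residue_ring 2) \<and>
      4 \<le> n \<and>
      (\<exists>r\<in>carrier R. (r [^]\<^bsub>R\<^esub> (2::nat) \<oplus>\<^bsub>R\<^esub> r) [^]\<^bsub>R\<^esub> (n - 1) \<noteq> \<zero>\<^bsub>R\<^esub>) \<and>
      (\<exists>e\<in>E. let f = \<one>\<^bsub>R\<^esub> \<ominus>\<^bsub>R\<^esub> e in
        ideal_pow R J (n - 1) = sandwich R e (ideal_pow R J (n - 1)) f \<and>
        sandwich R e (ideal_pow R J (n - 2)) f = sandwich R e (ideal_pow R J (n - 1)) f \<and>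
        index2_add_subgroup R (sandwich R e (ideal_pow R J 2) f) (sandwich R e J f)))"

text \<open>Coefficients are on the left of the powers of \<open>a\<close>, as \<^const>\<open>eval\<close> has it.\<close>

definition null_ideal :: "('a, 'm) ring_scheme \<Rightarrow> (nat \<Rightarrow> 'a) set"
  where "null_ideal R =
    {p \<in> carrier (UP R). \<forall>a\<in>carrier R. eval R R (\<lambda>c. c) a p = \<zero>\<^bsub>R\<^esub>}"

end

theory Submission
  imports Defs
begin

text \<open>Write \<open>n = k + 3\<close> for the nilpotency of \<open>J\<close> and split \<open>J\<close> into its Peirce components along
  \<open>1 = e + f\<close>. Two coincidences of the ring make the argument work. First, \<open>\<F>\<^sub>2 \<oplus> \<F>\<^sub>2\<close> is Boolean,
  so \<open>j = r\<^sup>2 + r\<close> lies in \<open>J\<close> for every \<open>r\<close>. Second, \<open>e J f\<close> has, modulo \<open>e J\<^sup>2 f\<close>, exactly one nonzero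
  element, represented by some \<open>b\<close>, and only the corner \<open>e J f\<close> can stand at either end of
  a nonzero product of \<open>n - 1\<close> elements of \<open>J\<close> (\<open>longest_product_corners\<close>). Hence \<open>j\<^bsup>n-1\<^esup>\<close> is unchanged
  when its first factor is replaced by \<open>b\<close>: \<open>b j\<^bsup>n-2\<^esup> = j\<^bsup>n-1\<^esup>\<close> for all \<open>j\<close> in \<open>J\<close>
  (\<open>corner_representative_mult_pow\<close>).

  Put \<open>W = X\<^sup>2 + X\<close>. Powers of \<open>W\<close> have central coefficients, so with the coefficients \<open>a\<close> on the
  left, \<open>a W\<^sup>i\<close> evaluates to \<open>a j\<^sup>i\<close>. The identity therefore says that \<open>b W\<^bsup>n-2\<^esup> - W\<^bsup>n-1\<^esup>\<close> is a null
  polynomial. Multiplied on the right by the constant \<open>e\<close> it becomes \<open>b e W\<^bsup>n-2\<^esup> - e W\<^bsup>n-1\<^esup>\<close>.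
  Now \<open>b e = 0\<close>, because \<open>b\<close> ends in \<open>f\<close>, whereas \<open>e j\<^bsup>n-1\<^esup> = j\<^bsup>n-1\<^esup>\<close>, because \<open>b\<close> begins with \<open>e\<close>.
  The product evaluates to \<open>-j\<^bsup>n-1\<^esup>\<close>, which is nonzero for a suitable \<open>r\<close>.

  The filtration by powers of \<open>J\<close> requires \<open>J\<close> to be a two-sided ideal, although it is defined by left
  ideals only, and \<open>J\<^sup>n = 0\<close>, which follows from \<open>J\<^bsup>n-1\<^esup> = e J\<^bsup>n-1\<^esup> f\<close>.\<close>

section \<open>The Jacobson radical is a two-sided ideal\<close>

context ring
begin

text \<open>The left ideal \<open>M + R t\<close> strictly contains \<open>M\<close>, so it is the whole ring.\<close>

lemma maximal_left_ideal_cofactor: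
  assumes M: "maximal_left_ideal M R" and t: "t \<in> carrier R" "t \<notin> M" and a: "a \<in> carrier R"
  obtains m s where "m \<in> M" "s \<in> carrier R" "a = m \<oplus> s \<otimes> t"
proof -
  define K where "K = {m \<oplus> s \<otimes> t | m s. m \<in> M \<and> s \<in> carrier R}"
  have lM: "left_ideal M R" using M by (simp add: maximal_left_ideal_def)
  have sM: "additive_subgroup M R" and clM: "\<And>x y. x \<in> carrier R \<Longrightarrow> y \<in> M \<Longrightarrow> x \<otimes> y \<in> M"
    using lM by (auto simp: left_ideal_def)
  interpret M: additive_subgroup M R by (fact sM)
  note Mc = M.a_Hcarr
  have "subgroup K (add_monoid R)"
  proof (rule add.subgroupI)
    show "K \<subseteq> carrier R" using t Mc by (auto simp: K_def)
    have "\<zero> \<oplus> \<zero> \<otimes> t \<in> K" using M.zero_closed unfolding K_def by blast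
    then show "K \<noteq> {}" by blast
  next
    fix x assume "x \<in> K"
    then obtain m s where x: "x = m \<oplus> s \<otimes> t" "m \<in> M" "s \<in> carrier R" by (auto simp: K_def)
    then have "\<ominus> x = \<ominus> m \<oplus> (\<ominus> s) \<otimes> t"
      using t Mc[of m] by (simp add: minus_add l_minus)
    then show "\<ominus> x \<in> K" using x M.a_inv_closed[of m] by (auto simp: K_def)
  next
    fix x y assume "x \<in> K" "y \<in> K"
    then obtain m s m' s' where xy: "x = m \<oplus> s \<otimes> t" "m \<in> M" "s \<in> carrier R"
      "y = m' \<oplus> s' \<otimes> t" "m' \<in> M" "s' \<in> carrier R" by (auto simp: K_def)
    then have "x \<oplus> y = (m \<oplus> m') \<oplus> (s \<oplus> s') \<otimes> t"
      using t Mc[of m] Mc[of m'] by (simp add: l_distr a_ac)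
    then show "x \<oplus> y \<in> K" using xy M.a_closed[of m m'] by (auto simp: K_def)
  qed
  moreover have "c \<otimes> x \<in> K" if "x \<in> K" "c \<in> carrier R" for c x
  proof -
    from that obtain m s where x: "x = m \<oplus> s \<otimes> t" "m \<in> M" "s \<in> carrier R" by (auto simp: K_def)
    then have "c \<otimes> x = c \<otimes> m \<oplus> (c \<otimes> s) \<otimes> t"
      using t Mc[of m] that by (simp add: r_distr m_assoc)
    then show ?thesis using x clM that by (auto simp: K_def)
  qed
  ultimately have lK: "left_ideal K R"
    by (simp add: left_ideal_def additive_subgroup_def)
  have "M \<subseteq> K"
  proof
    fix m assume m: "m \<in> M"
    then have "m = m \<oplus> \<zero> \<otimes> t" using t Mc[of m] by simp
    then show "m \<in> K" using m unfolding K_def by blast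
  qed
  moreover have "t \<in> K"
  proof -
    have "t = \<zero> \<oplus> \<one> \<otimes> t" using t by simp
    then show ?thesis using M.zero_closed unfolding K_def by blast
  qed
  ultimately have "K = carrier R" using M lK t unfolding maximal_left_ideal_def by blast
  then have "a \<in> K" using a by simp
  then show ?thesis using that unfolding K_def by blast
qed

lemma left_ideal_one: "left_ideal L R \<Longrightarrow> \<one> \<in> L \<Longrightarrow> L = carrier R"
  unfolding left_ideal_def
  by (metis additive_subgroup.a_subset r_one subset_antisym subsetI)

text \<open>Right multiplication by \<open>a\<close> induces an embedding of the module \<open>R/K\<close> into the simple module
  \<open>R/M\<close>, so the preimage \<open>K\<close> of \<open>M\<close> is either everything or again maximal.\<close>

lemma maximal_left_ideal_preimage:
  assumes M: "maximal_left_ideal M R" and a: "a \<in> carrier R"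
  defines "K \<equiv> {y \<in> carrier R. y \<otimes> a \<in> M}"
  shows "K = carrier R \<or> maximal_left_ideal K R"
proof (cases "K = carrier R")
  case False
  have lM: "left_ideal M R" using M by (simp add: maximal_left_ideal_def)
  have sM: "additive_subgroup M R" and clM: "\<And>x y. x \<in> carrier R \<Longrightarrow> y \<in> M \<Longrightarrow> x \<otimes> y \<in> M"
    using lM by (auto simp: left_ideal_def)
  interpret M: additive_subgroup M R by (fact sM)
  have "subgroup K (add_monoid R)"
  proof (rule add.subgroupI)
    have "\<zero> \<in> K" using a M.zero_closed by (simp add: K_def)
    then show "K \<noteq> {}" by blast
  qed (use a in \<open>auto simp: K_def l_distr l_minus\<close>)
  then have lK: "left_ideal K R"
    using a clM by (auto simp: left_ideal_def additive_subgroup_def K_def m_assoc)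
  have "L = K" if L: "left_ideal L R" and KL: "K \<subseteq> L" and proper: "L \<noteq> carrier R" for L
  proof (rule ccontr)
    assume "L \<noteq> K"
    interpret L: additive_subgroup L R using L by (simp add: left_ideal_def)
    obtain l where l: "l \<in> L" "l \<notin> K" using KL \<open>L \<noteq> K\<close> by blast
    have lc: "l \<in> carrier R" using l(1) by (rule L.a_Hcarr)
    \<comment> \<open>Writing \<open>a = m + s l a\<close> puts \<open>1 - s l\<close> into \<open>K\<close>, hence \<open>1\<close> into \<open>L\<close>.\<close>
    have "l \<otimes> a \<notin> M" using l(2) lc by (simp add: K_def)
    then obtain m s where ms: "m \<in> M" "s \<in> carrier R" "a = m \<oplus> s \<otimes> (l \<otimes> a)"
      using maximal_left_ideal_cofactor[OF M _ _ a, of "l \<otimes> a"] lc a by blast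
    have mc: "m \<in> carrier R" using ms(1) by (rule M.a_Hcarr)
    have "(\<one> \<ominus> s \<otimes> l) \<otimes> a = a \<ominus> s \<otimes> (l \<otimes> a)"
      using lc a ms(2) by (simp add: a_minus_def l_distr l_minus m_assoc)
    also have "\<dots> = m"
      using lc a ms(2) mc by (subst ms(3)) (simp add: a_minus_def a_assoc r_neg)
    finally have "\<one> \<ominus> s \<otimes> l \<in> L" using ms lc KL by (auto simp: K_def)
    moreover have "s \<otimes> l \<in> L" using L ms(2) l(1) by (simp add: left_ideal_def)
    ultimately have "(\<one> \<ominus> s \<otimes> l) \<oplus> s \<otimes> l \<in> L" by (rule L.a_closed)
    moreover have "(\<one> \<ominus> s \<otimes> l) \<oplus> s \<otimes> l = \<one>"
      using ms(2) lc by (simp add: a_minus_def a_assoc l_neg)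
    ultimately show False using left_ideal_one[OF L] proper by simp
  qed
  then show ?thesis using lK False by (auto simp: maximal_left_ideal_def)
qed simp

lemma ideal_jacobson_radical: "ideal (jacobson_radical R) R"
proof (rule idealI)
  let ?J = "jacobson_radical R"
  have mem: "x \<in> ?J \<longleftrightarrow> x \<in> carrier R \<and> (\<forall>M. maximal_left_ideal M R \<longrightarrow> x \<in> M)" for x
    by (auto simp: jacobson_radical_def)
  have sub: "additive_subgroup M R" if "maximal_left_ideal M R" for M
    using that by (simp add: maximal_left_ideal_def left_ideal_def)
  show "ring R" by (rule ring_axioms)
  show "subgroup ?J (add_monoid R)"
  proof (rule add.subgroupI)
    show "?J \<noteq> {}"
      using mem[of \<zero>] additive_subgroup.zero_closed[OF sub] by auto
    show "?J \<subseteq> carrier R" by (simp add: jacobson_radical_def)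
    show "\<ominus> x \<in> ?J" if "x \<in> ?J" for x
      using that additive_subgroup.a_inv_closed[OF sub]
      by (auto simp: mem)
    show "x \<oplus> y \<in> ?J" if "x \<in> ?J" "y \<in> ?J" for x y
      using that additive_subgroup.a_closed[OF sub] by (auto simp: mem)
  qed
  fix x a assume x: "x \<in> ?J" and a: "a \<in> carrier R"
  show "a \<otimes> x \<in> ?J"
    using x a by (auto simp: mem maximal_left_ideal_def left_ideal_def)
  show "x \<otimes> a \<in> ?J"
    unfolding mem
  proof (intro conjI allI impI)
    show "x \<otimes> a \<in> carrier R" using x a by (simp add: mem)
    fix M assume "maximal_left_ideal M R"
    then have "x \<in> {y \<in> carrier R. y \<otimes> a \<in> M}"
      using maximal_left_ideal_preimage[of M a] a x by (auto simp: mem)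
    then show "x \<otimes> a \<in> M" by simp
  qed
qed

end

section \<open>Powers of an ideal\<close>

context ring
begin

lemma ideals_set_one: "\<one>\<^bsub>ideals_set R\<^esub> = carrier R"
  by (simp add: ideals_set_def)

lemma ideals_set_mult: "I \<otimes>\<^bsub>ideals_set R\<^esub> K = I \<cdot> K"
  by (simp add: ideals_set_def)

lemma ideal_ideal_pow: "ideal I R \<Longrightarrow> ideal (ideal_pow R I k) R"
  by (induction k) (auto simp: ideals_set_one ideals_set_mult oneideal intro: ideal_prod_is_ideal)

lemma ideal_pow_add:
  assumes "ideal I R"
  shows "ideal_pow R I (k + l) = ideal_pow R I k \<cdot> ideal_pow R I l"
  by (induction l)
     (simp_all add: ideals_set_one ideals_set_mult ideal_prod_one ideal_ideal_pow ideal_prod_assoc assms)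

lemma ideal_pow_mult_mem:
  assumes "ideal I R" "x \<in> ideal_pow R I k" "y \<in> ideal_pow R I l"
  shows "x \<otimes> y \<in> ideal_pow R I (k + l)"
  using assms by (simp add: ideal_pow_add ideal_prod.prod)

lemma ideal_pow_1_mem:
  assumes "ideal I R" "x \<in> I"
  shows "x \<in> ideal_pow R I 1"
  using ideal_prod.prod[of \<one> "carrier R" x I R] assms ideal.Icarr[OF assms]
  by (simp add: ideals_set_mult ideals_set_one)

lemma nat_pow_mem_ideal_pow:
  assumes "ideal I R" "x \<in> I"
  shows "x [^] k \<in> ideal_pow R I k"
  by (induction k) (auto simp: ideals_set_one ideals_set_mult assms intro: ideal_prod.prod)

text \<open>The least exponent in the definition of the nilpotency exists as soon as \<open>I\<close> has some power
  that vanishes; here \<open>I\<^sup>k I\<^sup>k \<subseteq> e I\<^sup>k (f e) I\<^sup>k f = 0\<close>.\<close>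

lemma ideal_pow_nilpotency_if_sandwich:
  assumes I: "ideal I R" and e: "e \<in> carrier R" and f: "f \<in> carrier R" and fe: "f \<otimes> e = \<zero>"
    and k: "0 < k" and sw: "ideal_pow R I k = sandwich R e (ideal_pow R I k) f"
  shows "ideal_pow R I (nilpotency R I) = {\<zero>}"
proof -
  note idk = ideal_ideal_pow[OF I, of k]
  have prod0: "x \<otimes> y = \<zero>" if "x \<in> ideal_pow R I k" "y \<in> ideal_pow R I k" for x y
  proof -
    have "x \<in> sandwich R e (ideal_pow R I k) f" "y \<in> sandwich R e (ideal_pow R I k) f"
      using that by (auto intro: subsetD[OF equalityD1[OF sw]])
    then obtain u v where uv: "u \<in> carrier R" "v \<in> carrier R" "x = e \<otimes> u \<otimes> f" "y = e \<otimes> v \<otimes> f"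
      using ideal.Icarr[OF idk]
      unfolding sandwich_def by blast
    then have "x \<otimes> y = e \<otimes> u \<otimes> (f \<otimes> e) \<otimes> (v \<otimes> f)"
      using e f by (simp add: m_assoc)
    then show ?thesis using fe uv e f by simp
  qed
  have "ideal_pow R I (k + k) \<subseteq> {\<zero>}"
  proof
    fix s assume "s \<in> ideal_pow R I (k + k)"
    then have "s \<in> ideal_pow R I k \<cdot> ideal_pow R I k" by (simp add: ideal_pow_add I)
    then show "s \<in> {\<zero>}" by induction (simp_all add: prod0)
  qed
  then have "ideal_pow R I (k + k) = {\<zero>}"
    using additive_subgroup.zero_closed[OF ideal.axioms(1)[OF ideal_ideal_pow[OF I]]] by blast
  then have "\<exists>l. 0 < l \<and> ideal_pow R I l = {\<zero>}" using k by (intro exI[of _ "k + k"]) simp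
  from LeastI_ex[OF this] show ?thesis by (simp add: nilpotency_def)
qed

end

section \<open>Squares modulo the radical\<close>

text \<open>Every element \<open>x\<close> of \<open>\<F>\<^sub>2 \<oplus> \<F>\<^sub>2\<close> satisfies \<open>x\<^sup>2 + x = 0\<close>.\<close>

lemma (in ideal) square_plus_self_mem:
  assumes iso: "R Quot I \<simeq> RDirProd (residue_ring 2) (residue_ring 2)" and r: "r \<in> carrier R"
  shows "r \<otimes> r \<oplus> r \<in> I"
proof -
  let ?S = "RDirProd (residue_ring 2) (residue_ring 2)"
  obtain h where h: "h \<in> ring_iso (R Quot I) ?S"
    using iso by (auto simp: is_ring_iso_def)
  have hom: "h \<in> ring_hom (R Quot I) ?S" and bij: "bij_betw h (carrier (R Quot I)) (carrier ?S)"
    using h by (auto simp: ring_iso_def)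
  have "cring (residue_ring 2)" by (rule residues.cring) (simp add: residues_def)
  then have S: "ring ?S" by (intro RDirProd_ring cring.axioms)
  have Q: "ring (R Quot I)" by (rule quotient_is_ring)
  have zero: "h \<zero>\<^bsub>R Quot I\<^esub> = \<zero>\<^bsub>?S\<^esub>"
    using ring_hom_zero[OF hom Q S] .
  have ann: "x \<otimes>\<^bsub>?S\<^esub> x \<oplus>\<^bsub>?S\<^esub> x = \<zero>\<^bsub>?S\<^esub>" if "x \<in> carrier ?S" for x
  proof -
    obtain y z where x: "x = (y, z)" by (cases x)
    then have "y = 0 \<or> y = 1" "z = 0 \<or> z = 1"
      using that by (auto simp: RDirProd_carrier residue_ring_def)
    then show ?thesis
      unfolding x by (auto simp: RDirProd_def DirProd_def monoid.defs residue_ring_def)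
  qed
  let ?c = "I +> r"
  have c: "?c \<in> carrier (R Quot I)"
    using ring_hom_closed[OF rcos_ring_hom r] .
  have "h (?c \<otimes>\<^bsub>R Quot I\<^esub> ?c \<oplus>\<^bsub>R Quot I\<^esub> ?c) = h ?c \<otimes>\<^bsub>?S\<^esub> h ?c \<oplus>\<^bsub>?S\<^esub> h ?c"
    using c by (simp add: ring_hom_add[OF hom] ring_hom_mult[OF hom] ring.ring_simprules(1,5)[OF Q])
  also have "\<dots> = h \<zero>\<^bsub>R Quot I\<^esub>"
    using ann ring_hom_closed[OF hom c] zero by simp
  finally have "?c \<otimes>\<^bsub>R Quot I\<^esub> ?c \<oplus>\<^bsub>R Quot I\<^esub> ?c = \<zero>\<^bsub>R Quot I\<^esub>"
    by (rule inj_onD[OF bij_betw_imp_inj_on[OF bij]])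
       (use c in \<open>simp_all add: ring.ring_simprules[OF Q]\<close>)
  moreover have "I +> (r \<otimes> r \<oplus> r) = ?c \<otimes>\<^bsub>R Quot I\<^esub> ?c \<oplus>\<^bsub>R Quot I\<^esub> ?c"
    using r by (simp add: ring_hom_add[OF rcos_ring_hom] ring_hom_mult[OF rcos_ring_hom])
  ultimately have "I +> (r \<otimes> r \<oplus> r) = I" by (simp add: FactRing_def)
  then show ?thesis using a_rcos_self[of "r \<otimes> r \<oplus> r"] r by simp
qed

section \<open>Products of maximal length\<close>

context ring
begin

text \<open>Besides \<open>H\<close> itself there is exactly one coset of \<open>H\<close>; any of its elements serves as \<open>b\<close>.\<close>

lemma index2_add_subgroup_representative:
  assumes ix: "index2_add_subgroup R H K" and K: "K \<subseteq> carrier R"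
  obtains b where "b \<in> K" "\<And>y. y \<in> K \<Longrightarrow> y \<in> H \<or> y \<ominus> b \<in> H"
proof -
  let ?G = "(add_monoid R)\<lparr>carrier := K\<rparr>"
  have sg: "subgroup H ?G" and card: "card (rcosets\<^bsub>?G\<^esub> H) = 2"
    using ix by (auto simp: index2_add_subgroup_def)
  have HK: "H \<subseteq> K" and zero: "\<zero> \<in> H"
    using subgroup.subset[OF sg] subgroup.one_closed[OF sg] by auto
  define C where "C y = {h \<oplus> y | h. h \<in> H}" for y
  have cos: "rcosets\<^bsub>?G\<^esub> H = C ` K"
    by (auto simp: RCOSETS_def r_coset_def C_def)
  have Hc: "h \<in> carrier R" if "h \<in> H" for h using that HK K by blast
  have C0: "C \<zero> = H" using Hc by (force simp: C_def)
  have self: "y \<in> C y" if "y \<in> K" for y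
  proof -
    have "y = \<zero> \<oplus> y" using that K by (simp add: subset_eq)
    then show ?thesis using zero unfolding C_def by blast
  qed
  have "H \<in> C ` K" using C0 HK zero by blast
  moreover obtain A B where "C ` K = {A, B}" using card[unfolded cos card_2_iff] by metis
  ultimately obtain B where B: "C ` K = {H, B}" by (metis insert_commute insertE singletonD)
  then have "B \<in> C ` K" by blast
  then obtain b where b: "b \<in> K" and two: "C ` K = {H, C b}" using B by blast
  show ?thesis
  proof (rule that[OF b])
    fix y assume y: "y \<in> K"
    then have "C y = H \<or> C y = C b" using two by blast
    then show "y \<in> H \<or> y \<ominus> b \<in> H"
    proof
      assume "C y = C b"
      then obtain h where h: "h \<in> H" "y = h \<oplus> b" using self[OF y] by (auto simp: C_def)
      moreover have "b \<in> carrier R" using b K by blast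
      ultimately have "y \<ominus> b = h" using Hc by (simp add: a_minus_def a_assoc r_neg)
      then show ?thesis using h by simp
    qed (use self[OF y] in simp)
  qed
qed

text \<open>The whole product lies in \<open>J\<^bsup>k+2\<^esup> = e J\<^bsup>k+2\<^esup> f\<close>. Split \<open>u\<close> and \<open>w\<close> along \<open>1 = e + f\<close>.
  The part \<open>e u e\<close> of \<open>u\<close> is followed by an element of \<open>e J\<^bsup>k+1\<^esup> f = e J\<^bsup>k+2\<^esup> f\<close>, so its contribution
  lies in \<open>J\<^bsup>k+3\<^esup> = 0\<close>; symmetrically for the part \<open>f w f\<close> of \<open>w\<close>.\<close>

lemma longest_product_corners:
  assumes J: "ideal J R" and e: "e \<in> carrier R" and ee: "e \<otimes> e = e" and f: "f = \<one> \<ominus> e"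
    and top: "ideal_pow R J (k + 2) = sandwich R e (ideal_pow R J (k + 2)) f"
    and pre: "sandwich R e (ideal_pow R J (k + 1)) f = sandwich R e (ideal_pow R J (k + 2)) f"
    and nil: "ideal_pow R J (k + 3) = {\<zero>}"
    and u: "u \<in> J" and v: "v \<in> ideal_pow R J k" and w: "w \<in> J"
  shows "u \<otimes> v \<otimes> w = (e \<otimes> u \<otimes> f) \<otimes> v \<otimes> (e \<otimes> w \<otimes> f)"
proof -
  have fc [simp]: "f \<in> carrier R" and ef: "e \<oplus> f = \<one>"
    using e f by (simp_all add: a_minus_def a_lcomm[of e \<one>] r_neg)
  have ff: "f \<otimes> f = f"
  proof -
    have "f \<otimes> f = f \<ominus> (e \<ominus> e \<otimes> e)"
      using e unfolding f a_minus_def by (simp add: l_distr r_distr l_minus r_minus ee a_ac r_neg)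
    then show ?thesis using e ee by (simp add: a_minus_def r_neg)
  qed
  have uc [simp]: "u \<in> carrier R" and wc [simp]: "w \<in> carrier R"
    using u w ideal.Icarr[OF J] by auto
  have vc [simp]: "v \<in> carrier R"
    using v ideal.Icarr[OF ideal_ideal_pow[OF J]] by auto
  have split: "e \<otimes> x \<oplus> f \<otimes> x = x" "x \<otimes> e \<oplus> x \<otimes> f = x" if "x \<in> carrier R" for x
    using that e ef by (simp_all flip: l_distr r_distr)
  have corner_top: "e \<otimes> x \<otimes> f \<in> ideal_pow R J (k + 2)" if "x \<in> ideal_pow R J (k + 1)" for x
  proof -
    have "e \<otimes> x \<otimes> f \<in> sandwich R e (ideal_pow R J (k + 1)) f"
      unfolding sandwich_def using that by (rule imageI)
    then show ?thesis
      by (rule subsetD[OF equalityD2[OF top], OF subsetD[OF equalityD1[OF pre]]])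
  qed
  have v1: "v \<otimes> w \<in> ideal_pow R J (k + 1)"
    using ideal_pow_mult_mem[OF J v ideal_pow_1_mem[OF J w]] .
  have uv1: "u \<otimes> f \<otimes> v \<in> ideal_pow R J (k + 1)"
    using ideal_pow_mult_mem[OF J ideal_pow_1_mem[OF J ideal.I_r_closed[OF J u fc]] v]
    by (simp add: add.commute)
  have left0: "u \<otimes> (e \<otimes> (v \<otimes> w) \<otimes> f) = \<zero>"
    using ideal_pow_mult_mem[OF J ideal_pow_1_mem[OF J u] corner_top[OF v1]] nil
    by (simp add: numeral_3_eq_3)
  have right0: "(e \<otimes> (u \<otimes> f \<otimes> v) \<otimes> f) \<otimes> w = \<zero>"
    using ideal_pow_mult_mem[OF J corner_top[OF uv1] ideal_pow_1_mem[OF J w]] nil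
    by (simp add: numeral_3_eq_3)
  have "u \<otimes> v \<otimes> w \<in> ideal_pow R J (k + 2)"
    using ideal_pow_mult_mem[OF J ideal_pow_1_mem[OF J u] v1]
    by (simp add: m_assoc numeral_2_eq_2)
  then have "u \<otimes> v \<otimes> w \<in> sandwich R e (ideal_pow R J (k + 2)) f"
    by (rule subsetD[OF equalityD1[OF top]])
  then obtain z where z: "z \<in> carrier R" "u \<otimes> v \<otimes> w = e \<otimes> z \<otimes> f"
    using ideal.Icarr[OF ideal_ideal_pow[OF J]] unfolding sandwich_def by blast
  have "u \<otimes> v \<otimes> w = e \<otimes> (u \<otimes> v \<otimes> w) \<otimes> f"
  proof -
    have "e \<otimes> (e \<otimes> z \<otimes> f) \<otimes> f = (e \<otimes> e) \<otimes> z \<otimes> (f \<otimes> f)" using e z by (simp add: m_assoc)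
    then show ?thesis using z ee ff by simp
  qed
  also have "\<dots> = e \<otimes> (u \<otimes> (e \<otimes> (v \<otimes> w) \<oplus> f \<otimes> (v \<otimes> w))) \<otimes> f"
    by (simp add: split m_assoc)
  also have "\<dots> = e \<otimes> (u \<otimes> (e \<otimes> (v \<otimes> w) \<otimes> f)) \<oplus> e \<otimes> u \<otimes> f \<otimes> v \<otimes> w \<otimes> f"
    using e by (simp add: r_distr l_distr m_assoc)
  also have "\<dots> = (e \<otimes> u \<otimes> f \<otimes> v) \<otimes> w \<otimes> f"
    using e by (simp add: left0)
  also have "\<dots> = ((e \<otimes> u \<otimes> f \<otimes> v) \<otimes> e \<oplus> (e \<otimes> u \<otimes> f \<otimes> v) \<otimes> f) \<otimes> w \<otimes> f"
    using e by (simp add: split)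
  also have "\<dots> = (e \<otimes> u \<otimes> f) \<otimes> v \<otimes> (e \<otimes> w \<otimes> f) \<oplus> ((e \<otimes> (u \<otimes> f \<otimes> v) \<otimes> f) \<otimes> w) \<otimes> f"
    using e by (simp add: l_distr m_assoc)
  also have "\<dots> = (e \<otimes> u \<otimes> f) \<otimes> v \<otimes> (e \<otimes> w \<otimes> f)"
    using e by (simp add: right0)
  finally show ?thesis .
qed

text \<open>By the previous lemma both sides are determined by \<open>j\<^sup>k\<close> and the corner \<open>y = e j f\<close>: they are
  \<open>b j\<^sup>k y\<close> and \<open>y j\<^sup>k y\<close>. If \<open>y\<close> is congruent to \<open>b\<close> modulo \<open>J\<^sup>2\<close>, the two products differ by an
  element of \<open>J\<^bsup>k+3\<^esup> = 0\<close>; if \<open>y\<close> is in \<open>J\<^sup>2\<close>, both of them lie in \<open>J\<^bsup>k+3\<^esup>\<close>.\<close>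

lemma corner_representative_mult_pow:
  assumes J: "ideal J R" and e: "e \<in> carrier R" and ee: "e \<otimes> e = e" and f: "f = \<one> \<ominus> e"
    and top: "ideal_pow R J (k + 2) = sandwich R e (ideal_pow R J (k + 2)) f"
    and pre: "sandwich R e (ideal_pow R J (k + 1)) f = sandwich R e (ideal_pow R J (k + 2)) f"
    and nil: "ideal_pow R J (k + 3) = {\<zero>}"
    and b: "b \<in> J" "e \<otimes> b \<otimes> f = b"
    and rep: "\<And>y. y \<in> sandwich R e J f \<Longrightarrow>
      y \<in> sandwich R e (ideal_pow R J 2) f \<or> y \<ominus> b \<in> sandwich R e (ideal_pow R J 2) f"
    and j: "j \<in> J"
  shows "b \<otimes> j [^] (k + 1) = j [^] (k + 2)"
proof -
  define y where "y = e \<otimes> j \<otimes> f"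
  have fc: "f \<in> carrier R" using e f by simp
  have jc: "j \<in> carrier R" and bc: "b \<in> carrier R" using j b(1) ideal.Icarr[OF J] by auto
  have yJ: "y \<in> J" unfolding y_def by (intro ideal.I_r_closed[OF J] ideal.I_l_closed[OF J] j e fc)
  then have yc: "y \<in> carrier R" by (rule ideal.Icarr[OF J])
  note corners = longest_product_corners[OF J e ee f top pre nil _ nat_pow_mem_ideal_pow[OF J j] j]
  have jk: "j [^] k \<in> carrier R" using jc by simp
  have pow1: "j [^] (k + 1) = j [^] k \<otimes> j" by simp
  have pow2: "j [^] (k + 2) = j \<otimes> j [^] k \<otimes> j"
    using jc nat_pow_mult[of j 1 "k + 1"] by (simp add: m_assoc)
  have lhs: "b \<otimes> j [^] (k + 1) = b \<otimes> j [^] k \<otimes> y"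
    using corners[OF b(1)] b(2) bc jc jk unfolding pow1 y_def by (simp add: m_assoc)
  have rhs: "j [^] (k + 2) = y \<otimes> j [^] k \<otimes> y"
    using corners[OF j] unfolding pow2 y_def by simp
  have sq: "x \<in> ideal_pow R J 2" if "x \<in> sandwich R e (ideal_pow R J 2) f" for x
  proof -
    note J2 = ideal_ideal_pow[OF J, of 2]
    show ?thesis
      using that ideal.I_r_closed[OF J2 ideal.I_l_closed[OF J2 _ e] fc] by (auto simp: sandwich_def)
  qed
  have long1: "x \<otimes> j [^] k \<otimes> z = \<zero>" if "x \<in> ideal_pow R J 2" "z \<in> J" for x z
  proof -
    have "x \<otimes> j [^] k \<otimes> z \<in> ideal_pow R J (2 + k + 1)"
      by (intro ideal_pow_mult_mem[OF J] that nat_pow_mem_ideal_pow[OF J j] ideal_pow_1_mem[OF J])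
    then show ?thesis using nil by (simp add: numeral_3_eq_3)
  qed
  have long2: "z \<otimes> j [^] k \<otimes> x = \<zero>" if "x \<in> ideal_pow R J 2" "z \<in> J" for x z
  proof -
    have "z \<otimes> j [^] k \<otimes> x \<in> ideal_pow R J (1 + k + 2)"
      by (intro ideal_pow_mult_mem[OF J] that nat_pow_mem_ideal_pow[OF J j] ideal_pow_1_mem[OF J])
    then show ?thesis using nil by (simp add: numeral_3_eq_3)
  qed
  have "y \<in> sandwich R e J f" using j by (auto simp: sandwich_def y_def)
  then consider "y \<in> ideal_pow R J 2" | "y \<ominus> b \<in> ideal_pow R J 2" using rep sq by blast
  then show ?thesis
  proof cases
    case 1
    then show ?thesis unfolding lhs rhs by (simp add: long2 b(1) yJ)
  next
    case 2
    have "y \<otimes> j [^] k \<otimes> y = ((y \<ominus> b) \<oplus> b) \<otimes> j [^] k \<otimes> y"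
      using yc bc by (simp add: a_minus_def a_assoc l_neg)
    also have "\<dots> = (y \<ominus> b) \<otimes> j [^] k \<otimes> y \<oplus> b \<otimes> j [^] k \<otimes> y"
      using yc bc jk by (simp add: l_distr)
    also have "\<dots> = b \<otimes> j [^] k \<otimes> y"
      using long1[OF 2 yJ] yc bc jk by simp
    finally show ?thesis unfolding lhs rhs by simp
  qed
qed

end

section \<open>Right evaluation\<close>

context UP_ring
begin

abbreviation right_eval :: "'a \<Rightarrow> (nat \<Rightarrow> 'a) \<Rightarrow> 'a"
  where "right_eval \<equiv> eval R R (\<lambda>c. c)"

lemma right_eval_bound:
  assumes p: "p \<in> carrier P" and r: "r \<in> carrier R" and N: "deg R p \<le> N"
  shows "right_eval r p = (\<Oplus>i\<in>{..N}. coeff P p i \<otimes> r [^] i)"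
proof -
  have "(\<Oplus>i\<in>{..deg R p}. coeff P p i \<otimes> r [^] i) = (\<Oplus>i\<in>{..N}. coeff P p i \<otimes> r [^] i)"
    by (rule R.add.finprod_mono_neutral_cong_left)
       (use p r N in \<open>auto simp: deg_aboveD\<close>)
  then show ?thesis using p by (simp add: eval_def P_def)
qed

lemma right_eval_closed: "p \<in> carrier P \<Longrightarrow> r \<in> carrier R \<Longrightarrow> right_eval r p \<in> carrier R"
  by (simp add: right_eval_bound[OF _ _ order_refl] R.finsum_closed Pi_def)

lemma right_eval_add:
  assumes p: "p \<in> carrier P" and q: "q \<in> carrier P" and r: "r \<in> carrier R"
  shows "right_eval r (p \<oplus>\<^bsub>P\<^esub> q) = right_eval r p \<oplus> right_eval r q"
proof -
  let ?N = "max (deg R p) (deg R q)"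
  show ?thesis
    using p q r deg_add[OF p q]
    by (simp add: right_eval_bound[where N = ?N] R.l_distr R.finsum_addf Pi_def)
qed

lemma right_eval_const:
  assumes "a \<in> carrier R" "r \<in> carrier R"
  shows "right_eval r (monom P a 0) = a"
  using assms by (simp add: right_eval_bound[where N = 0])

lemma right_eval_minus:
  assumes p: "p \<in> carrier P" and q: "q \<in> carrier P" and r: "r \<in> carrier R"
  shows "right_eval r (p \<ominus>\<^bsub>P\<^esub> q) = right_eval r p \<ominus> right_eval r q"
proof -
  have "right_eval r (p \<ominus>\<^bsub>P\<^esub> q) \<oplus> right_eval r q = right_eval r p"
    using p q r by (simp add: right_eval_add[symmetric] P.minus_closed a_minus_def
        P.a_assoc P.l_neg)
  then show ?thesis
    using right_eval_closed[of _ r] p q r P.minus_closed[OF p q]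
    by (metis R.add.inv_solve_right R.minus_eq)
qed

lemma coeff_mult_monom:
  assumes p: "p \<in> carrier P" and c: "c \<in> carrier R"
  shows "coeff P (p \<otimes>\<^bsub>P\<^esub> monom P c k) n = (if k \<le> n then coeff P p (n - k) \<otimes> c else \<zero>)"
proof -
  have "coeff P (p \<otimes>\<^bsub>P\<^esub> monom P c k) n =
      (\<Oplus>i\<in>{..n}. if i = n - k \<and> k \<le> n then coeff P p i \<otimes> c else \<zero>)"
    using p c by (auto intro!: R.finsum_cong' simp: Pi_def)
  also have "\<dots> = (if k \<le> n then coeff P p (n - k) \<otimes> c else \<zero>)"
  proof (cases "k \<le> n")
    case True
    then show ?thesis
      using R.add.finprod_singleton[of "n - k" "{..n}" "\<lambda>i. coeff P p i \<otimes> c"] p c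
      by (simp add: Pi_def eq_commute[of _ "n - k"])
  qed simp
  finally show ?thesis .
qed

lemma monom_one_commute_const:
  assumes c: "c \<in> carrier R"
  shows "monom P \<one> k \<otimes>\<^bsub>P\<^esub> monom P c 0 = monom P c 0 \<otimes>\<^bsub>P\<^esub> monom P \<one> k"
  using c by (intro up_eqI) (auto simp: coeff_mult_monom simp del: coeff_mult)

text \<open>With coefficients on the left, the powers of the argument appear on the right, so the factor
  \<open>X\<close> on the right of a polynomial is evaluated separately.\<close>

lemma right_eval_mult_X:
  assumes p: "p \<in> carrier P" and r: "r \<in> carrier R"
  shows "right_eval r (p \<otimes>\<^bsub>P\<^esub> monom P \<one> 1) = right_eval r p \<otimes> r"
proof -
  let ?q = "p \<otimes>\<^bsub>P\<^esub> monom P \<one> 1"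
  let ?N = "deg R p"
  have q: "?q \<in> carrier P" using p by simp
  have dq: "deg R ?q \<le> Suc ?N"
    by (rule deg_aboveI) (use p in \<open>auto simp: coeff_mult_monom deg_aboveD simp del: coeff_mult\<close>)
  have "right_eval r ?q = (\<Oplus>i\<in>{..Suc ?N}. coeff P ?q i \<otimes> r [^] i)"
    by (rule right_eval_bound[OF q r dq])
  also have "\<dots> = (\<Oplus>i\<in>{..?N}. coeff P ?q (Suc i) \<otimes> r [^] Suc i) \<oplus> coeff P ?q 0 \<otimes> r [^] (0::nat)"
    by (rule R.finsum_Suc2) (use q r in \<open>simp add: Pi_def del: coeff_mult\<close>)
  also have "\<dots> = (\<Oplus>i\<in>{..?N}. coeff P p i \<otimes> r [^] i \<otimes> r)"
    using p r by (simp add: coeff_mult_monom R.m_assoc Pi_def del: coeff_mult)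
  also have "\<dots> = right_eval r p \<otimes> r"
    using p r by (simp add: right_eval_bound[OF p r order_refl] R.finsum_ldistr Pi_def)
  finally show ?thesis .
qed

text \<open>In a ring of characteristic 2 the roots of this polynomial are the idempotents.\<close>

definition idem_poly :: "nat \<Rightarrow> 'a"
  where "idem_poly = monom P \<one> 1 \<otimes>\<^bsub>P\<^esub> monom P \<one> 1 \<oplus>\<^bsub>P\<^esub> monom P \<one> 1"

lemma idem_poly_closed: "idem_poly \<in> carrier P"
  by (simp add: idem_poly_def)

lemma idem_poly_commute_const:
  assumes c: "c \<in> carrier R"
  shows "idem_poly [^]\<^bsub>P\<^esub> k \<otimes>\<^bsub>P\<^esub> monom P c 0 = monom P c 0 \<otimes>\<^bsub>P\<^esub> idem_poly [^]\<^bsub>P\<^esub> (k :: nat)"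
proof -
  let ?X = "monom P \<one> 1" and ?C = "monom P c 0"
  have X: "?X \<otimes>\<^bsub>P\<^esub> ?C = ?C \<otimes>\<^bsub>P\<^esub> ?X" using monom_one_commute_const[OF c] .
  have carr: "?X \<in> carrier P" "?C \<in> carrier P" using c by auto
  have "?X \<otimes>\<^bsub>P\<^esub> ?X \<otimes>\<^bsub>P\<^esub> ?C = ?C \<otimes>\<^bsub>P\<^esub> (?X \<otimes>\<^bsub>P\<^esub> ?X)"
    using X carr by (metis P.m_assoc)
  then have W: "idem_poly \<otimes>\<^bsub>P\<^esub> ?C = ?C \<otimes>\<^bsub>P\<^esub> idem_poly"
    using X carr by (simp add: idem_poly_def P.l_distr P.r_distr del: monom_mult)
  show ?thesis
    using W carr idem_poly_closed P.group_commutes_pow by blast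
qed

text \<open>Right evaluation is not multiplicative. It is multiplicative here because the second factor has
  central coefficients, so that it is enough to split off one factor \<open>X\<close> at a time.\<close>

lemma right_eval_const_mult_idem_poly_pow:
  assumes a: "a \<in> carrier R" and r: "r \<in> carrier R"
  shows "right_eval r (monom P a 0 \<otimes>\<^bsub>P\<^esub> idem_poly [^]\<^bsub>P\<^esub> (k :: nat)) = a \<otimes> (r \<otimes> r \<oplus> r) [^] k"
proof (induction k)
  case 0
  then show ?case using a r by (simp add: right_eval_const)
next
  case (Suc k)
  let ?X = "monom P \<one> 1" and ?p = "monom P a 0 \<otimes>\<^bsub>P\<^esub> idem_poly [^]\<^bsub>P\<^esub> k"
  have p: "?p \<in> carrier P" using a idem_poly_closed by simp
  have X: "?X \<in> carrier P" by simp
  have "monom P a 0 \<otimes>\<^bsub>P\<^esub> idem_poly [^]\<^bsub>P\<^esub> Suc k = ?p \<otimes>\<^bsub>P\<^esub> idem_poly"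
    using a idem_poly_closed by (simp add: P.m_assoc)
  also have "\<dots> = ?p \<otimes>\<^bsub>P\<^esub> ?X \<otimes>\<^bsub>P\<^esub> ?X \<oplus>\<^bsub>P\<^esub> ?p \<otimes>\<^bsub>P\<^esub> ?X"
    unfolding idem_poly_def using p[unfolded idem_poly_def] X
    by (simp only: P.r_distr P.m_assoc UP_mult_closed)
  finally have "right_eval r (monom P a 0 \<otimes>\<^bsub>P\<^esub> idem_poly [^]\<^bsub>P\<^esub> Suc k) =
      right_eval r ?p \<otimes> r \<otimes> r \<oplus> right_eval r ?p \<otimes> r"
    using p X r by (simp only: right_eval_add right_eval_mult_X UP_mult_closed)
  then show ?case
    using Suc a r by (simp add: R.r_distr R.m_assoc)
qed

definition two_term_poly :: "nat \<Rightarrow> 'a \<Rightarrow> 'a \<Rightarrow> nat \<Rightarrow> 'a"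
  where "two_term_poly k a c =
    monom P a 0 \<otimes>\<^bsub>P\<^esub> idem_poly [^]\<^bsub>P\<^esub> k \<ominus>\<^bsub>P\<^esub> monom P c 0 \<otimes>\<^bsub>P\<^esub> idem_poly [^]\<^bsub>P\<^esub> Suc k"

lemma two_term_poly_closed: "a \<in> carrier R \<Longrightarrow> c \<in> carrier R \<Longrightarrow> two_term_poly k a c \<in> carrier P"
  unfolding two_term_poly_def
  by (intro P.minus_closed UP_mult_closed monom_closed P.nat_pow_closed idem_poly_closed)

lemma right_eval_two_term_poly:
  assumes "a \<in> carrier R" "c \<in> carrier R" "s \<in> carrier R"
  shows "right_eval s (two_term_poly k a c) =
    a \<otimes> (s \<otimes> s \<oplus> s) [^] k \<ominus> c \<otimes> (s \<otimes> s \<oplus> s) [^] Suc k"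
  unfolding two_term_poly_def using assms
  by (simp only: right_eval_minus right_eval_const_mult_idem_poly_pow UP_mult_closed
      monom_closed P.nat_pow_closed idem_poly_closed)

lemma const_mult_idem_poly_pow_mult_const:
  assumes a: "a \<in> carrier R" and d: "d \<in> carrier R"
  shows "monom P a 0 \<otimes>\<^bsub>P\<^esub> idem_poly [^]\<^bsub>P\<^esub> i \<otimes>\<^bsub>P\<^esub> monom P d 0 =
    monom P (a \<otimes> d) 0 \<otimes>\<^bsub>P\<^esub> idem_poly [^]\<^bsub>P\<^esub> (i :: nat)"
proof -
  let ?C = "\<lambda>a. monom P a 0" and ?Wi = "idem_poly [^]\<^bsub>P\<^esub> i"
  have W: "?Wi \<in> carrier P" using idem_poly_closed by simp
  have "?C a \<otimes>\<^bsub>P\<^esub> ?Wi \<otimes>\<^bsub>P\<^esub> ?C d = ?C a \<otimes>\<^bsub>P\<^esub> (?Wi \<otimes>\<^bsub>P\<^esub> ?C d)"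
    using a d W by (intro P.m_assoc monom_closed)
  also have "\<dots> = ?C a \<otimes>\<^bsub>P\<^esub> (?C d \<otimes>\<^bsub>P\<^esub> ?Wi)"
    using d by (simp only: idem_poly_commute_const)
  also have "\<dots> = (?C a \<otimes>\<^bsub>P\<^esub> ?C d) \<otimes>\<^bsub>P\<^esub> ?Wi"
    using a d W by (intro P.m_assoc[symmetric] monom_closed)
  also have "?C a \<otimes>\<^bsub>P\<^esub> ?C d = ?C (a \<otimes> d)"
    using a d monom_mult[of a d 0 0] by simp
  finally show ?thesis .
qed

text \<open>In the value at \<open>s\<close> the constant \<open>d\<close> ends up between the coefficients and the powers of
  \<open>s\<^sup>2 + s\<close>, so it can annihilate one of the two terms and keep the other.\<close>

lemma two_term_poly_mult_const:
  assumes "a \<in> carrier R" "c \<in> carrier R" "d \<in> carrier R"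
  shows "two_term_poly k a c \<otimes>\<^bsub>P\<^esub> monom P d 0 = two_term_poly k (a \<otimes> d) (c \<otimes> d)"
  unfolding two_term_poly_def a_minus_def using assms
  by (simp only: P.l_distr P.l_minus P.a_inv_closed UP_mult_closed monom_closed P.nat_pow_closed
      idem_poly_closed const_mult_idem_poly_pow_mult_const)

end

section \<open>The null ideal of a counterexample ring\<close>

text \<open>The witness is \<open>two_term_poly (k + 1) b 1\<close> with the constant \<open>e\<close> on its right, where \<open>k + 3\<close> is the
  nilpotency of \<open>J\<close>.\<close>

lemma (in UP_ring) null_ideal_not_ideal:
  assumes ce: "counterexample_ring R E"
    and E: "\<And>e. e \<in> E \<Longrightarrow> e \<in> carrier R" "\<And>e. e \<in> E \<Longrightarrow> e \<otimes> e = e"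
  shows "\<not> ideal (null_ideal R) P"
proof
  assume N: "ideal (null_ideal R) P"
  define J where "J = jacobson_radical R"
  \<comment> \<open>With this shift the exponents \<open>n - 2\<close> and \<open>n - 1\<close> involve no truncated subtraction.\<close>
  define k where "k = nilpotency R J - 3"
  have J: "ideal J R" unfolding J_def by (rule R.ideal_jacobson_radical)
  note ce' = ce[unfolded counterexample_ring_def Let_def, folded J_def]
  have n: "nilpotency R J = k + 3" using ce' by (simp add: k_def)
  have iso: "R Quot J \<simeq> RDirProd (residue_ring 2) (residue_ring 2)" using ce' by blast
  obtain r where r: "r \<in> carrier R" and r_pow: "(r \<otimes> r \<oplus> r) [^] (k + 2) \<noteq> \<zero>"
    using ce' unfolding n by (auto simp: numeral_2_eq_2)
  obtain e where e_mem: "e \<in> E"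
    and top: "ideal_pow R J (k + 2) = sandwich R e (ideal_pow R J (k + 2)) (\<one> \<ominus> e)"
    and pre: "sandwich R e (ideal_pow R J (k + 1)) (\<one> \<ominus> e)
      = sandwich R e (ideal_pow R J (k + 2)) (\<one> \<ominus> e)"
    and ix: "index2_add_subgroup R (sandwich R e (ideal_pow R J 2) (\<one> \<ominus> e)) (sandwich R e J (\<one> \<ominus> e))"
    using ce' unfolding n by (auto simp del: monoid.nat_pow_Suc)
  have e: "e \<in> carrier R" and ee: "e \<otimes> e = e"
    using E e_mem by auto
  define f where "f = \<one> \<ominus> e"
  have fc: "f \<in> carrier R" using e by (simp add: f_def)
  have fe: "f \<otimes> e = \<zero>" using e ee by (simp add: f_def a_minus_def R.l_distr R.l_minus R.r_neg)
  have ff: "f \<otimes> f = f"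
    using e fe by (subst (2) f_def) (simp add: a_minus_def R.r_distr R.r_minus fc)
  have Jc: "\<And>x. x \<in> J \<Longrightarrow> x \<in> carrier R" using ideal.Icarr[OF J] .
  have nil: "ideal_pow R J (k + 3) = {\<zero>}"
    using R.ideal_pow_nilpotency_if_sandwich[OF J e fc fe _ top[folded f_def]] by (simp add: n)
  have "sandwich R e J f \<subseteq> carrier R" using e fc Jc by (auto simp: sandwich_def)
  then obtain b where b_mem: "b \<in> sandwich R e J f"
    and rep: "\<And>y. y \<in> sandwich R e J f \<Longrightarrow>
      y \<in> sandwich R e (ideal_pow R J 2) f \<or> y \<ominus> b \<in> sandwich R e (ideal_pow R J 2) f"
    using R.index2_add_subgroup_representative[OF ix[folded f_def]] by blast
  obtain x where x: "x \<in> J" "b = e \<otimes> x \<otimes> f" using b_mem by (auto simp: sandwich_def)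
  have xc: "x \<in> carrier R" using x Jc by simp
  have bJ: "b \<in> J"
    unfolding x(2) by (intro ideal.I_r_closed[OF J] ideal.I_l_closed[OF J] x(1) e fc)
  have bc: "b \<in> carrier R" using bJ Jc by simp
  have ebf: "e \<otimes> b \<otimes> f = b"
  proof -
    have "e \<otimes> b \<otimes> f = (e \<otimes> e) \<otimes> x \<otimes> (f \<otimes> f)" unfolding x(2) using e fc xc by (simp add: R.m_assoc)
    then show ?thesis by (simp add: ee ff x(2))
  qed
  have be: "b \<otimes> e = \<zero>" unfolding x(2) using e fc xc fe by (simp add: R.m_assoc)
  have b_pow: "b \<otimes> j [^] (k + 1) = j [^] (k + 2)" if "j \<in> J" for j
    by (rule R.corner_representative_mult_pow[OF J e ee f_def top[folded f_def] pre[folded f_def] nil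
          bJ ebf rep that])

  have "two_term_poly (k + 1) b \<one> \<in> null_ideal R"
    unfolding null_ideal_def P_def[symmetric]
  proof (intro CollectI conjI ballI)
    show "two_term_poly (k + 1) b \<one> \<in> carrier P" using two_term_poly_closed bc by simp
    fix s assume s: "s \<in> carrier R"
    have "s \<otimes> s \<oplus> s \<in> J" by (rule ideal.square_plus_self_mem[OF J iso s])
    from b_pow[OF this] show "right_eval s (two_term_poly (k + 1) b \<one>) = \<zero>"
      using right_eval_two_term_poly[OF bc R.one_closed s] s by (simp only: a_minus_def) (simp add: R.r_neg)
  qed
  then have "two_term_poly (k + 1) b \<one> \<otimes>\<^bsub>P\<^esub> monom P e 0 \<in> null_ideal R"
    using ideal.I_r_closed[OF N] e by simp
  then have "two_term_poly (k + 1) \<zero> e \<in> null_ideal R"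
    using two_term_poly_mult_const[OF bc R.one_closed e] be e by simp
  then have "right_eval r (two_term_poly (k + 1) \<zero> e) = \<zero>"
    using r unfolding null_ideal_def by blast
  moreover have "right_eval r (two_term_poly (k + 1) \<zero> e) = \<ominus> (e \<otimes> (r \<otimes> r \<oplus> r) [^] (k + 2))"
    using right_eval_two_term_poly[OF R.zero_closed e r, of "k + 1"] e r by (simp add: a_minus_def)
  ultimately have zero: "e \<otimes> (r \<otimes> r \<oplus> r) [^] (k + 2) = \<zero>"
    using e r by (metis R.minus_minus R.minus_zero R.m_closed R.nat_pow_closed R.a_closed)
  \<comment> \<open>The top power is fixed by \<open>e\<close> since it begins with \<open>b\<close>.\<close>
  have "(r \<otimes> r \<oplus> r) [^] (k + 2) = b \<otimes> (r \<otimes> r \<oplus> r) [^] (k + 1)"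
    using b_pow[OF ideal.square_plus_self_mem[OF J iso r]] by simp
  moreover have "e \<otimes> b = b"
    unfolding x(2) using e ee fc xc by (metis R.m_assoc R.m_closed)
  ultimately have "e \<otimes> (r \<otimes> r \<oplus> r) [^] (k + 2) = (r \<otimes> r \<oplus> r) [^] (k + 2)"
    using e bc r by (metis R.m_assoc R.nat_pow_closed R.m_closed R.a_closed)
  then show False using zero r_pow by simp
qed

theorem theorem5p3:
  fixes R :: "('a, 'm) ring_scheme"
    and cs :: "(nat \<times> 'f ring) list"
    and \<phi> :: "'a set \<Rightarrow> (nat \<times> nat \<Rightarrow> 'f) list"
    and es :: "'a list"
  assumes "ring R"
    and "finite (carrier R)"
    and "wedderburn_decomposition R cs \<phi>"
    and "wedderburn_idempotents R cs \<phi> es"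
    and "counterexample_ring R (set es)"
  shows "\<not> ideal (null_ideal R) (UP R)"
proof -
  interpret ring R by (fact assms(1))
  interpret UP_ring R "UP R" by (simp add: UP_ring_def ring_axioms)
  show ?thesis
    using assms(4) by (intro null_ideal_not_ideal[OF assms(5)]) (auto simp: wedderburn_idempotents_def)
qed

end
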